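(* Consider a doubly periodic uniform Cartesian grid $T_d$ and the two-step scheme $\mathbf U^n\mapsto\mathbf U^{n+1/2}\mapsto\mathbf U^{n+1}$ described in the context: an explicit finite-volume step $\mathbf U^n\mapsto\mathbf U^{n+1/2}$ for the hyperbolic part with an entropy-satisfying numerical flux, followed by the semi-implicit capillary step $\mathbf U^{n+1/2}\mapsto\mathbf U^{n+1}$, in which the second order discrete operator $\operatorname{div}_{1,\Delta}(h\nabla_{1,\Delta}\boldsymbol m^T)$ is the compact finite-difference operator given in the context. Suppose $h_K^n>0$ for every cell $K$ and that the hyperbolic CFL condition $$\max_{K,\,e\in\partial K}\frac{\Delta t}{m_K}\,m_e\,\big\|\nabla_{\mathbf U}\mathcal F(\mathbf U_K^n)\big\|<a$$ holds, where $a\in(0,1)$ is the CFL constant of the numerical flux. Then $h_K^{n+1}>0$ for every cell $K$, and the scheme is energy stable: $$\sum_KE_{tot}(\mathbf U_K^{n+1})\,m_K\le\sum_KE_{tot}(\mathbf U_K^n)\,m_K.$$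
   Context: Data: $\Phi,\sigma:(0,\infty)\to(0,\infty)$ are smooth, $\pi(h)=h\Phi'(h)-\Phi(h)$ with $\pi'(h)>0$ for $h>0$ (so $\Phi$ is strictly convex). $\mathcal{E}_{\mathrm{cap}}:[0,\infty)\to[0,\infty)$ is a bijection with $\mathcal{E}_{\mathrm{cap}}(0)=0$, such that $\alpha(s)=\sqrt{2\mathcal{E}_{\mathrm{cap}}(\sqrt s)/s}$ extends to a positive $C^1$ function on $[0,\infty)$. Let $d=2$. For $h>0$, $\boldsymbol v\in\mathbb{R}^2$, with $q=\mathcal{E}_{\mathrm{cap}}^{-1}(h\|\boldsymbol v\|^2/(2\sigma(h)))$, $$f(h,\boldsymbol v)=\sqrt{\sigma(h)}\sqrt h\left(2\frac{\alpha'(q^2)h}{\alpha(q^2)^2\sigma(h)}\boldsymbol v\otimes\boldsymbol v+\alpha(q^2)\mathrm I_2\right),\qquad \mathbf g(h,\boldsymbol v)=\left(\frac{\sigma'(h)h}{2\sigma(h)}+\frac12+2\frac{\alpha'(q^2)}{\alpha(q^2)}q^2\right)h\boldsymbol v.$$ Unknowns, flux and energy: $\mathbf U=(h,h\boldsymbol u,h\boldsymbol v)$ with $\boldsymbol u,\boldsymbol v\in\mathbb{R}^2$; $\mathcal F(\mathbf U)=(h\boldsymbol u,\ h\boldsymbol u\otimes\boldsymbol u+\pi(h)\mathrm I_2,\ h\boldsymbol v\otimes\boldsymbol u)$; $\nabla_{\mathbf U}\mathcal F$ is its Jacobian, measured in some fixed norm. For $h>0$, $E_{tot}(\mathbf U)=\frac{\|h\boldsymbol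 u\|^2}{2h}+\Phi(h)+\frac{\|h\boldsymbol v\|^2}{2h}$. Mesh: cells $K=(i,j)$, $i\in\mathbb{Z}/n_x$, $j\in\mathbb{Z}/n_y$ (periodic), of measure $m_K=\Delta x\Delta y$; edges $e\in\partial K$ of measure $m_e$; $K_e$ is the neighbour of $K$ across $e$; $n_{e,K}$ is the outward unit normal. For grid functions, $(a,b)_{T_d}=\sum_Km_K\langle a_K,b_K\rangle$. Hyperbolic step: $\mathbf U_K^{n+1/2}=\mathbf U_K^n-\frac{\Delta t}{m_K}\sum_{e\in\partial K}m_e\mathbf G_{e,K}^n$ with $\mathbf G_{e,K}^n=\mathbf G(\mathbf U_K^n,\mathbf U_{K_e}^n,n_{e,K})$. The numerical flux is conservative ($\mathbf G_{e,K}^n=-\mathbf G_{e,K_e}^n$) and entropy satisfying with CFL constant $a\in(0,1)$, meaning: whenever $h_K^n>0$ for all $K$ and the CFL condition $\max_{K,e}\frac{\Delta t}{m_K}m_e\|\nabla_{\mathbf U}\mathcal F(\mathbf U_K^n)\|<a$ holds, one has $h_K^{n+1/2}>0$ for all $K$ and $$E_{tot}(\mathbf U_K^{n+1/2})\le E_{tot}(\mathbf U_K^n)-\frac{\Delta t}{m_K}\sum_{e\in\partial K}m_eH_{e,K}^n$$ for a conservative numerical entropy flux $H_{e,K}^n=-H_{e,K_e}^n$. Capillary step: $\mathbf U_K^{n+1}=\mathbf U_K^{n+1/2}+\Delta t\,\mathbf M_K^{n+1}$, where, with $f_K=f(h_K^{n+1},\boldsymbol v_K^{n+1/2})$ and $\mathbf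 g_K=\mathbf g(h_K^{n+1},\boldsymbol v_K^{n+1/2})$, $$\mathbf M_K^{n+1}=\begin{pmatrix}0\\ -\nabla_{3,\Delta}(\mathbf g^t\boldsymbol v^{n+1})_K+\operatorname{div}_{1,\Delta}\big(h^{n+1}\nabla_{1,\Delta}(f\boldsymbol v^{n+1})^T\big)_K\\ -\mathbf g_K\operatorname{div}_{3,\Delta}(\boldsymbol u^{n+1})_K-f_K\operatorname{div}_{1,\Delta}\big(h^{n+1}\nabla_{1,\Delta}(\boldsymbol u^{n+1})^T\big)_K\end{pmatrix}.$$ Here $\nabla_{3,\Delta}$ (scalar to vector grid functions) and $\operatorname{div}_{3,\Delta}$ (vector to scalar) are linear and dual: $(a,\nabla_{3,\Delta}\varphi)_{T_d}=-(\operatorname{div}_{3,\Delta}a,\varphi)_{T_d}$ for all grid functions $a$ (vector), $\varphi$ (scalar). The compact operator: for a scalar grid function $h$ and a vector grid function $\boldsymbol m=(m^x,m^y)$, $$\operatorname{div}_{1,\Delta}(h\nabla_{1,\Delta}\boldsymbol m^T)=\begin{pmatrix}\partial^0_x(h\,\partial_xm^x)+\partial^{00}_y(h\,\partial_x^{00}m^y)\\ \partial^{00}_x(h\,\partial_y^{00}m^x)+\partial^0_y(h\,\partial_ym^y)\end{pmatrix},$$ where $(\partial_xm)_{i+1/2,j}=\frac{m_{i+1,j}-m_{i,j}}{\Delta x}$, $(\partial_x^0p)_{i,j}=\frac{p_{i+1/2,j}-p_{i-1/2,j}}{\Delta x}$, $(\partial_x^{00}m)_{i,j}=\frac{m_{i+1,j}-m_{i-1,j}}{2\Delta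 x}$, and similarly $\partial_y,\partial_y^0,\partial_y^{00}$ in the index $j$ with $\Delta y$; at half-integer points $h_{i+1/2,j}=\frac12(h_{i+1,j}+h_{i,j})$ and $h_{i,j+1/2}=\frac12(h_{i,j+1}+h_{i,j})$. *)

theory Defs
  imports "HOL-Analysis.Analysis" "Berlekamp_Zassenhaus.Finite_Field"
begin

section \<open>Physical data\<close>

text \<open>A state is \<open>\<^bold>U = (h, h\<^bold>u, h\<^bold>v)\<close>; the last two components are the momenta, not the velocities.\<close>

type_synonym state = "real \<times> (real^2) \<times> (real^2)"
type_synonym state_flux = "(real^2) \<times> (real^2^2) \<times> (real^2^2)"

definition height :: "state \<Rightarrow> real"
  where "height U = fst U"

definition vel_u :: "state \<Rightarrow> real^2"
  where "vel_u U = (1 / height U) *\<^sub>R fst (snd U)"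

definition vel_v :: "state \<Rightarrow> real^2"
  where "vel_v U = (1 / height U) *\<^sub>R snd (snd U)"

definition smooth_on_pos :: "(real \<Rightarrow> real) \<Rightarrow> bool"
  where "smooth_on_pos F \<longleftrightarrow> (\<forall>k. \<forall>x>0. (deriv ^^ k) F differentiable (at x))"

definition pressure :: "(real \<Rightarrow> real) \<Rightarrow> real \<Rightarrow> real"
  where "pressure \<Phi> h = h * deriv \<Phi> h - \<Phi> h"

definition C1_on :: "(real \<Rightarrow> real) \<Rightarrow> real set \<Rightarrow> bool"
  where "C1_on F S \<longleftrightarrow> F differentiable_on S \<and>
           continuous_on S (\<lambda>s. vector_derivative F (at s within S))"

text \<open>\<open>\<alpha>\<close> is a positive \<open>C\<^sup>1\<close> extension to \<open>[0, \<infinity>)\<close> of \<open>s \<mapsto> sqrt (2 \<E>\<^sub>c\<^sub>a\<^sub>p (sqrt s) / s)\<close>;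
  the derivative at \<open>0\<close> is one-sided.\<close>

definition alpha_extension :: "(real \<Rightarrow> real) \<Rightarrow> (real \<Rightarrow> real) \<Rightarrow> bool"
  where "alpha_extension Ecap \<alpha> \<longleftrightarrow>
           (\<forall>s>0. \<alpha> s = sqrt (2 * Ecap (sqrt s) / s)) \<and> (\<forall>s\<ge>0. 0 < \<alpha> s) \<and> C1_on \<alpha> {0..}"

definition alpha_deriv :: "(real \<Rightarrow> real) \<Rightarrow> real \<Rightarrow> real"
  where "alpha_deriv \<alpha> s = vector_derivative \<alpha> (at s within {0..})"

definition outer :: "real^2 \<Rightarrow> real^2 \<Rightarrow> real^2^2"
  where "outer a b = (\<chi> i j. a $ i * b $ j)"

definition q_cap :: "(real \<Rightarrow> real) \<Rightarrow> (real \<Rightarrow> real) \<Rightarrow> real \<Rightarrow> real^2 \<Rightarrow> real"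
  where "q_cap \<sigma> Ecap h v = inv_into {0..} Ecap (h * (norm v)\<^sup>2 / (2 * \<sigma> h))"

definition f_cap :: "(real \<Rightarrow> real) \<Rightarrow> (real \<Rightarrow> real) \<Rightarrow> (real \<Rightarrow> real) \<Rightarrow> real \<Rightarrow> real^2 \<Rightarrow> real^2^2"
  where "f_cap \<sigma> Ecap \<alpha> h v =
    (let q = q_cap \<sigma> Ecap h v in
      (sqrt (\<sigma> h) * sqrt h) *\<^sub>R
        ((2 * (alpha_deriv \<alpha> (q\<^sup>2) * h / ((\<alpha> (q\<^sup>2))\<^sup>2 * \<sigma> h))) *\<^sub>R outer v v + \<alpha> (q\<^sup>2) *\<^sub>R mat 1))"

definition g_cap :: "(real \<Rightarrow> real) \<Rightarrow> (real \<Rightarrow> real) \<Rightarrow> (real \<Rightarrow> real) \<Rightarrow> real \<Rightarrow> real^2 \<Rightarrow> real^2"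
  where "g_cap \<sigma> Ecap \<alpha> h v =
    (let q = q_cap \<sigma> Ecap h v in
      (deriv \<sigma> h * h / (2 * \<sigma> h) + 1 / 2 + 2 * (alpha_deriv \<alpha> (q\<^sup>2) / \<alpha> (q\<^sup>2)) * q\<^sup>2) *\<^sub>R (h *\<^sub>R v))"

definition flux :: "(real \<Rightarrow> real) \<Rightarrow> state \<Rightarrow> state_flux"
  where "flux \<Phi> U =
    (let h = height U; u = vel_u U; v = vel_v U in
      (h *\<^sub>R u, h *\<^sub>R outer u u + pressure \<Phi> h *\<^sub>R mat 1, h *\<^sub>R outer v u))"

definition flux_jacobian ::
    "(real \<Rightarrow> real) \<Rightarrow> state \<Rightarrow> state \<Rightarrow>\<^sub>L state_flux"
  where "flux_jacobian \<Phi> U = Blinfun (frechet_derivative (flux \<Phi>) (at U))"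

definition Etot :: "(real \<Rightarrow> real) \<Rightarrow> state \<Rightarrow> real"
  where "Etot \<Phi> U = (case U of (h, m, w) \<Rightarrow>
           (norm m)\<^sup>2 / (2 * h) + \<Phi> h + (norm w)\<^sup>2 / (2 * h))"

definition is_norm :: "('a::real_vector \<Rightarrow> real) \<Rightarrow> bool"
  where "is_norm N \<longleftrightarrow> (\<forall>x. N x = 0 \<longleftrightarrow> x = 0) \<and> (\<forall>c x. N (c *\<^sub>R x) = \<bar>c\<bar> * N x) \<and>
           (\<forall>x y. N (x + y) \<le> N x + N y)"

section \<open>The doubly periodic mesh\<close>

text \<open>Cells are indexed by \<open>\<int>/n\<^sub>x \<times> \<int>/n\<^sub>y\<close> with \<open>n\<^sub>x = CARD('nx)\<close> and \<open>n\<^sub>y = CARD('ny)\<close>.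
  The unit step is \<open>of_int_mod_ring 1\<close>, because the numeral \<open>1\<close> is not available on
  \<open>'a mod_ring\<close> when \<open>CARD('a) = 1\<close>.\<close>

type_synonym ('nx, 'ny) cell = "'nx mod_ring \<times> 'ny mod_ring"

text \<open>A cell sees each of its four edges through its side, so that an edge is determined by a cell
  and a side; the edge \<open>e\<close> of \<open>K\<close> is the edge \<open>opp e\<close> of the neighbour \<open>nb e K\<close>.\<close>

datatype edge = West | East | South | North

definition edges :: "edge set"
  where "edges = {West, East, South, North}"

fun opp :: "edge \<Rightarrow> edge" where
  "opp West = East"
| "opp East = West"
| "opp South = North"
| "opp North = South"

fun nb :: "edge \<Rightarrow> ('nx::finite, 'ny::finite) cell \<Rightarrow> ('nx, 'ny) cell" where
  "nb West (i, j) = (i - of_int_mod_ring 1, j)"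
| "nb East (i, j) = (i + of_int_mod_ring 1, j)"
| "nb South (i, j) = (i, j - of_int_mod_ring 1)"
| "nb North (i, j) = (i, j + of_int_mod_ring 1)"

fun normal :: "edge \<Rightarrow> real^2" where
  "normal West = - axis 1 1"
| "normal East = axis 1 1"
| "normal South = - axis 2 1"
| "normal North = axis 2 1"

fun edge_measure :: "real \<Rightarrow> real \<Rightarrow> edge \<Rightarrow> real" where
  "edge_measure dx dy West = dy"
| "edge_measure dx dy East = dy"
| "edge_measure dx dy South = dx"
| "edge_measure dx dy North = dx"

definition cell_measure :: "real \<Rightarrow> real \<Rightarrow> real"
  where "cell_measure dx dy = dx * dy"

definition grid_inner ::
    "real \<Rightarrow> real \<Rightarrow> (('nx::finite, 'ny::finite) cell \<Rightarrow> 'b::real_inner) \<Rightarrow> (('nx, 'ny) cell \<Rightarrow> 'b) \<Rightarrow> real"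
  where "grid_inner dx dy a b = (\<Sum>K\<in>UNIV. cell_measure dx dy * inner (a K) (b K))"

definition grid_linear ::
    "((('nx, 'ny) cell \<Rightarrow> 'b::real_vector) \<Rightarrow> (('nx, 'ny) cell \<Rightarrow> 'c::real_vector)) \<Rightarrow> bool"
  where "grid_linear L \<longleftrightarrow>
    (\<forall>a b. L (\<lambda>K. a K + b K) = (\<lambda>K. L a K + L b K)) \<and>
    (\<forall>c a. L (\<lambda>K. c *\<^sub>R a K) = (\<lambda>K. c *\<^sub>R L a K))"

section \<open>The hyperbolic step\<close>

definition edge_flux ::
    "(state \<Rightarrow> state \<Rightarrow> real^2 \<Rightarrow> state) \<Rightarrow> (('nx::finite, 'ny::finite) cell \<Rightarrow> state) \<Rightarrow>
     ('nx, 'ny) cell \<Rightarrow> edge \<Rightarrow> state"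
  where "edge_flux G U K e = G (U K) (U (nb e K)) (normal e)"

definition conservative ::
    "(('nx::finite, 'ny::finite) cell \<Rightarrow> edge \<Rightarrow> 'b::real_vector) \<Rightarrow> bool"
  where "conservative F \<longleftrightarrow> (\<forall>K. \<forall>e\<in>edges. F K e = - F (nb e K) (opp e))"

definition hyperbolic_step ::
    "real \<Rightarrow> real \<Rightarrow> real \<Rightarrow> (state \<Rightarrow> state \<Rightarrow> real^2 \<Rightarrow> state) \<Rightarrow>
     (('nx::finite, 'ny::finite) cell \<Rightarrow> state) \<Rightarrow> ('nx, 'ny) cell \<Rightarrow> state"
  where "hyperbolic_step dx dy dt G U K =
    U K - (dt / cell_measure dx dy) *\<^sub>R (\<Sum>e\<in>edges. edge_measure dx dy e *\<^sub>R edge_flux G U K e)"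

definition CFL ::
    "(real \<Rightarrow> real) \<Rightarrow> (state \<Rightarrow>\<^sub>L state_flux \<Rightarrow> real) \<Rightarrow>
     real \<Rightarrow> real \<Rightarrow> real \<Rightarrow> real \<Rightarrow> (('nx::finite, 'ny::finite) cell \<Rightarrow> state) \<Rightarrow> bool"
  where "CFL \<Phi> N a dx dy dt U \<longleftrightarrow>
    (MAX (K, e)\<in>UNIV \<times> edges.
       dt / cell_measure dx dy * edge_measure dx dy e * N (flux_jacobian \<Phi> (U K))) < a"

text \<open>Conservativity and entropy satisfaction are properties of the numerical flux on the given
  mesh: they concern all positive grid data and all time steps. The mesh is fixed
  through the type arguments (numbers of cells) and \<open>dx\<close>, \<open>dy\<close>. The numerical entropy flux \<open>H\<^sub>e\<^sub>,\<^sub>K\<^sup>n\<close> may be any conservative edge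
  field; it need not be a function of the two adjacent states only.\<close>

definition conservative_flux ::
    "'nx::finite itself \<Rightarrow> 'ny::finite itself \<Rightarrow> (state \<Rightarrow> state \<Rightarrow> real^2 \<Rightarrow> state) \<Rightarrow> bool"
  where "conservative_flux TYPE('nx) TYPE('ny) G \<longleftrightarrow>
    (\<forall>U :: ('nx, 'ny) cell \<Rightarrow> state. (\<forall>K. 0 < height (U K)) \<longrightarrow> conservative (edge_flux G U))"

definition entropy_satisfying ::
    "'nx::finite itself \<Rightarrow> 'ny::finite itself \<Rightarrow> (real \<Rightarrow> real) \<Rightarrow>
     (state \<Rightarrow>\<^sub>L state_flux \<Rightarrow> real) \<Rightarrow>
     real \<Rightarrow> real \<Rightarrow> real \<Rightarrow> (state \<Rightarrow> state \<Rightarrow> real^2 \<Rightarrow> state) \<Rightarrow> bool"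
  where "entropy_satisfying TYPE('nx) TYPE('ny) \<Phi> N a dx dy G \<longleftrightarrow>
    (\<forall>(U :: ('nx, 'ny) cell \<Rightarrow> state) dt.
       0 < dt \<longrightarrow> (\<forall>K. 0 < height (U K)) \<longrightarrow> CFL \<Phi> N a dx dy dt U \<longrightarrow>
       (\<forall>K. 0 < height (hyperbolic_step dx dy dt G U K)) \<and>
       (\<exists>H. conservative H \<and>
         (\<forall>K. Etot \<Phi> (hyperbolic_step dx dy dt G U K) \<le>
              Etot \<Phi> (U K) -
                dt / cell_measure dx dy * (\<Sum>e\<in>edges. edge_measure dx dy e * H K e))))"

section \<open>The capillary step\<close>

text \<open>Quantities at half-integer points are stored one-sided: the value at \<open>(i + 1/2, j)\<close>
  (respectively \<open>(i, j + 1/2)\<close>) is stored in the cell \<open>(i, j)\<close>. Thus \<open>dfwd_x\<close> is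
  \<open>\<partial>\<^sub>x\<close> from cells to half points, \<open>dbwd_x\<close> is \<open>\<partial>\<^sub>x\<^sup>0\<close> from half points to cells, and
  \<open>avg_x\<close> is the average at half points.\<close>

definition dfwd_x :: "real \<Rightarrow> (('nx::finite, 'ny::finite) cell \<Rightarrow> real) \<Rightarrow> ('nx, 'ny) cell \<Rightarrow> real"
  where "dfwd_x dx m K = (m (nb East K) - m K) / dx"

definition dfwd_y :: "real \<Rightarrow> (('nx::finite, 'ny::finite) cell \<Rightarrow> real) \<Rightarrow> ('nx, 'ny) cell \<Rightarrow> real"
  where "dfwd_y dy m K = (m (nb North K) - m K) / dy"

definition dbwd_x :: "real \<Rightarrow> (('nx::finite, 'ny::finite) cell \<Rightarrow> real) \<Rightarrow> ('nx, 'ny) cell \<Rightarrow> real"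
  where "dbwd_x dx p K = (p K - p (nb West K)) / dx"

definition dbwd_y :: "real \<Rightarrow> (('nx::finite, 'ny::finite) cell \<Rightarrow> real) \<Rightarrow> ('nx, 'ny) cell \<Rightarrow> real"
  where "dbwd_y dy p K = (p K - p (nb South K)) / dy"

definition dcen_x :: "real \<Rightarrow> (('nx::finite, 'ny::finite) cell \<Rightarrow> real) \<Rightarrow> ('nx, 'ny) cell \<Rightarrow> real"
  where "dcen_x dx m K = (m (nb East K) - m (nb West K)) / (2 * dx)"

definition dcen_y :: "real \<Rightarrow> (('nx::finite, 'ny::finite) cell \<Rightarrow> real) \<Rightarrow> ('nx, 'ny) cell \<Rightarrow> real"
  where "dcen_y dy m K = (m (nb North K) - m (nb South K)) / (2 * dy)"

definition avg_x :: "(('nx::finite, 'ny::finite) cell \<Rightarrow> real) \<Rightarrow> ('nx, 'ny) cell \<Rightarrow> real"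
  where "avg_x h K = (h (nb East K) + h K) / 2"

definition avg_y :: "(('nx::finite, 'ny::finite) cell \<Rightarrow> real) \<Rightarrow> ('nx, 'ny) cell \<Rightarrow> real"
  where "avg_y h K = (h (nb North K) + h K) / 2"

text \<open>The compact operator \<open>m \<mapsto> div\<^sub>1(h \<nabla>\<^sub>1 m\<^sup>T)\<close>.\<close>

definition div_h_grad ::
    "real \<Rightarrow> real \<Rightarrow> (('nx::finite, 'ny::finite) cell \<Rightarrow> real) \<Rightarrow> (('nx, 'ny) cell \<Rightarrow> real^2) \<Rightarrow>
     ('nx, 'ny) cell \<Rightarrow> real^2"
  where "div_h_grad dx dy h m K =
    (let mx = (\<lambda>L. m L $ 1); my = (\<lambda>L. m L $ 2) in
      vector [dbwd_x dx (\<lambda>L. avg_x h L * dfwd_x dx mx L) K + dcen_y dy (\<lambda>L. h L * dcen_x dx my L) K,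
              dcen_x dx (\<lambda>L. h L * dcen_y dy mx L) K + dbwd_y dy (\<lambda>L. avg_y h L * dfwd_y dy my L) K])"

text \<open>The increment \<open>\<^bold>M\<^sup>n\<^sup>+\<^sup>1\<close> depends on the unknown new state \<open>Unew\<close> and, through the second
  argument of \<open>f\<close> and \<open>\<^bold>g\<close>, on the intermediate state \<open>Uhalf\<close>.\<close>

definition capillary_increment ::
    "(real \<Rightarrow> real) \<Rightarrow> (real \<Rightarrow> real) \<Rightarrow> (real \<Rightarrow> real) \<Rightarrow> real \<Rightarrow> real \<Rightarrow>
     ((('nx::finite, 'ny::finite) cell \<Rightarrow> real) \<Rightarrow> (('nx, 'ny) cell \<Rightarrow> real^2)) \<Rightarrow>
     ((('nx, 'ny) cell \<Rightarrow> real^2) \<Rightarrow> (('nx, 'ny) cell \<Rightarrow> real)) \<Rightarrow>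
     (('nx, 'ny) cell \<Rightarrow> state) \<Rightarrow> (('nx, 'ny) cell \<Rightarrow> state) \<Rightarrow> ('nx, 'ny) cell \<Rightarrow> state"
  where "capillary_increment \<sigma> Ecap \<alpha> dx dy grad3 div3 Uhalf Unew K =
    (let h = (\<lambda>L. height (Unew L)); u = (\<lambda>L. vel_u (Unew L)); v = (\<lambda>L. vel_v (Unew L));
         f = (\<lambda>L. f_cap \<sigma> Ecap \<alpha> (h L) (vel_v (Uhalf L)));
         g = (\<lambda>L. g_cap \<sigma> Ecap \<alpha> (h L) (vel_v (Uhalf L)))
     in (0,
         - grad3 (\<lambda>L. inner (g L) (v L)) K + div_h_grad dx dy h (\<lambda>L. f L *v v L) K,
         - (div3 u K *\<^sub>R g K) - f K *v div_h_grad dx dy h u K))"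

end

theory Submission
  imports Defs
begin

text \<open>
  Summing the discrete entropy inequality over the periodic grid, the conservative entropy flux
  cancels edge by edge, so the hyperbolic step does not increase the energy. In the capillary step
  \<open>h\<close> is frozen and the kinetic energies are convex in the momenta, so the
  implicit update loses at least \<open>- \<Delta>t \<langle>(\<^bold>u, \<^bold>v), \<^bold>M\<rangle>\<close>. This pairing vanishes
  because the increment is skew: \<open>\<nabla>\<^sub>3\<close> and \<open>div\<^sub>3\<close> are dual, the matrix \<open>f\<close> is symmetric, and
  \<open>div\<^sub>1 (h \<nabla>\<^sub>1 \<sqdot>\<^sup>T)\<close> is self-adjoint (its two mixed terms are adjoint to each other).
\<close>

lemma nb_opp [simp]: "nb (opp e) (nb e K) = K" "nb e (nb (opp e) K) = K"
  by (cases K; cases e; simp)+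

lemma sum_nb_shift:
  fixes p :: "('nx::finite, 'ny::finite) cell \<Rightarrow> 'b::comm_monoid_add"
  shows "(\<Sum>K\<in>UNIV. p (nb e K)) = (\<Sum>K\<in>UNIV. p K)"
  by (rule sum.reindex_bij_witness[where i = "nb (opp e)" and j = "nb e"]) auto

lemma sum_nb_adjoint:
  fixes p u :: "('nx::finite, 'ny::finite) cell \<Rightarrow> real"
  shows "(\<Sum>K\<in>UNIV. p (nb e K) * u K) = (\<Sum>K\<in>UNIV. p K * u (nb (opp e) K))"
  using sum_nb_shift[of "\<lambda>K. p K * u (nb (opp e) K)" e] by simp

text \<open>Summation by parts without boundary terms, thanks to periodicity. Half-point values are
  stored in the cell to their west, so moving the \<open>West\<close> shift of \<open>p\<close> onto
  \<open>u\<close> makes it an \<open>East\<close> shift, which is exactly the forward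
  difference.\<close>

lemma sum_dbwd_x:
  fixes p u :: "('nx::finite, 'ny::finite) cell \<Rightarrow> real"
  shows "(\<Sum>K\<in>UNIV. dbwd_x dx p K * u K) = - (\<Sum>K\<in>UNIV. p K * dfwd_x dx u K)"
  using sum_nb_adjoint[of p West u]
  by (simp add: dbwd_x_def dfwd_x_def algebra_simps sum_subtractf flip: sum_divide_distrib)
    (simp add: diff_divide_distrib mult.commute)

lemma sum_dbwd_y:
  fixes p u :: "('nx::finite, 'ny::finite) cell \<Rightarrow> real"
  shows "(\<Sum>K\<in>UNIV. dbwd_y dy p K * u K) = - (\<Sum>K\<in>UNIV. p K * dfwd_y dy u K)"
  using sum_nb_adjoint[of p South u]
  by (simp add: dbwd_y_def dfwd_y_def algebra_simps sum_subtractf flip: sum_divide_distrib)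
    (simp add: diff_divide_distrib mult.commute)

text \<open>The two shifts trade places under the adjoint, so the centred difference is
  skew.\<close>

lemma sum_dcen_x:
  fixes p u :: "('nx::finite, 'ny::finite) cell \<Rightarrow> real"
  shows "(\<Sum>K\<in>UNIV. dcen_x dx p K * u K) = - (\<Sum>K\<in>UNIV. p K * dcen_x dx u K)"
  using sum_nb_adjoint[of p West u] sum_nb_adjoint[of p East u]
  by (simp add: dcen_x_def algebra_simps sum_subtractf flip: sum_divide_distrib)
    (simp add: diff_divide_distrib mult.commute)

lemma sum_dcen_y:
  fixes p u :: "('nx::finite, 'ny::finite) cell \<Rightarrow> real"
  shows "(\<Sum>K\<in>UNIV. dcen_y dy p K * u K) = - (\<Sum>K\<in>UNIV. p K * dcen_y dy u K)"
  using sum_nb_adjoint[of p South u] sum_nb_adjoint[of p North u]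
  by (simp add: dcen_y_def algebra_simps sum_subtractf flip: sum_divide_distrib)
    (simp add: diff_divide_distrib mult.commute)

text \<open>The weak form: moving each outer difference onto \<open>w\<close> exposes how
  \<open>m\<close> and \<open>w\<close> enter.\<close>

lemma sum_inner_div_h_grad:
  fixes h :: "('nx::finite, 'ny::finite) cell \<Rightarrow> real" and m w :: "('nx, 'ny) cell \<Rightarrow> real^2"
  shows "(\<Sum>K\<in>UNIV. inner (div_h_grad dx dy h m K) (w K)) =
    - (\<Sum>K\<in>UNIV. avg_x h K * dfwd_x dx (\<lambda>L. m L $ 1) K * dfwd_x dx (\<lambda>L. w L $ 1) K)
    - (\<Sum>K\<in>UNIV. h K * dcen_x dx (\<lambda>L. m L $ 2) K * dcen_y dy (\<lambda>L. w L $ 1) K)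
    - (\<Sum>K\<in>UNIV. h K * dcen_y dy (\<lambda>L. m L $ 1) K * dcen_x dx (\<lambda>L. w L $ 2) K)
    - (\<Sum>K\<in>UNIV. avg_y h K * dfwd_y dy (\<lambda>L. m L $ 2) K * dfwd_y dy (\<lambda>L. w L $ 2) K)"
  by (simp add: div_h_grad_def Let_def inner_vec_def sum_2 distrib_right sum.distrib
      sum_dbwd_x sum_dbwd_y sum_dcen_x sum_dcen_y)

text \<open>In the weak form the first and last sums are symmetric in \<open>m\<close> and
  \<open>w\<close>, while the two mixed sums are swapped.\<close>

lemma div_h_grad_self_adjoint:
  fixes h :: "('nx::finite, 'ny::finite) cell \<Rightarrow> real" and m w :: "('nx, 'ny) cell \<Rightarrow> real^2"
  shows "(\<Sum>K\<in>UNIV. inner (div_h_grad dx dy h m K) (w K)) =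
    (\<Sum>K\<in>UNIV. inner (div_h_grad dx dy h w K) (m K))"
  by (simp add: sum_inner_div_h_grad mult.commute mult.left_commute)

lemma f_cap_symmetric: "transpose (f_cap \<sigma> Ecap \<alpha> h v) = f_cap \<sigma> Ecap \<alpha> h v"
  by (simp add: f_cap_def Let_def transpose_def outer_def mat_def vec_eq_iff mult.commute)

lemma sum_conservative_flux_zero:
  fixes H :: "('nx::finite, 'ny::finite) cell \<Rightarrow> edge \<Rightarrow> real"
  assumes "conservative H"
  shows "(\<Sum>K\<in>UNIV. \<Sum>e\<in>edges. edge_measure dx dy e * H K e) = 0"
proof -
  have "(\<Sum>K\<in>UNIV. H K e) = - (\<Sum>K\<in>UNIV. H K (opp e))" if "e \<in> edges" for e
  proof -
    have "(\<Sum>K\<in>UNIV. H K e) = (\<Sum>K\<in>UNIV. - H (nb e K) (opp e))"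
      using assms that unfolding conservative_def by (intro sum.cong) auto
    then show ?thesis
      using sum_nb_shift[of "\<lambda>K. H K (opp e)" e] by (simp add: sum_negf)
  qed
  \<comment> \<open>Opposite sides have equal measure, so \<open>West\<close> cancels
    \<open>East\<close> and \<open>South\<close> cancels \<open>North\<close>.\<close>
  from this[of West] this[of South] show ?thesis
    by (simp add: edges_def sum.distrib flip: sum_distrib_left)
qed

lemma hyperbolic_step_energy:
  fixes U :: "('nx::finite, 'ny::finite) cell \<Rightarrow> state"
  assumes "entropy_satisfying TYPE('nx) TYPE('ny) \<Phi> N a dx dy G" "0 < dt"
    and "\<forall>K. 0 < height (U K)" "CFL \<Phi> N a dx dy dt U"
  shows "0 < height (hyperbolic_step dx dy dt G U K)"
    and "(\<Sum>K\<in>UNIV. Etot \<Phi> (hyperbolic_step dx dy dt G U K)) \<le> (\<Sum>K\<in>UNIV. Etot \<Phi> (U K))"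
proof -
  from assms obtain H where H: "conservative H"
    and le: "\<And>K. Etot \<Phi> (hyperbolic_step dx dy dt G U K) \<le>
      Etot \<Phi> (U K) - dt / cell_measure dx dy * (\<Sum>e\<in>edges. edge_measure dx dy e * H K e)"
    unfolding entropy_satisfying_def by meson
  show "0 < height (hyperbolic_step dx dy dt G U K)"
    using assms unfolding entropy_satisfying_def by meson
  have "(\<Sum>K\<in>UNIV. Etot \<Phi> (hyperbolic_step dx dy dt G U K)) \<le>
    (\<Sum>K\<in>UNIV. Etot \<Phi> (U K) - dt / cell_measure dx dy * (\<Sum>e\<in>edges. edge_measure dx dy e * H K e))"
    by (intro sum_mono le)
  also have "\<dots> = (\<Sum>K\<in>UNIV. Etot \<Phi> (U K))
      - dt / cell_measure dx dy * (\<Sum>K\<in>UNIV. \<Sum>e\<in>edges. edge_measure dx dy e * H K e)"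
    by (simp add: sum_subtractf sum_distrib_left)
  finally show "(\<Sum>K\<in>UNIV. Etot \<Phi> (hyperbolic_step dx dy dt G U K)) \<le> (\<Sum>K\<in>UNIV. Etot \<Phi> (U K))"
    by (simp add: sum_conservative_flux_zero[OF H])
qed

text \<open>Convexity with the tangent taken at the new point \<open>m + d\<close>, as an implicit
  update requires.\<close>

lemma kinetic_energy_tangent:
  fixes m d :: "'b::real_inner"
  assumes "0 < h"
  shows "(norm (m + d))\<^sup>2 / (2 * h) \<le> (norm m)\<^sup>2 / (2 * h) + inner ((1 / h) *\<^sub>R (m + d)) d"
proof -
  \<comment> \<open>Expanding around the new point leaves the nonnegative remainder
    \<open>(norm d)\<^sup>2\<close>, the dissipation of the implicit step.\<close>
  have "(norm m)\<^sup>2 = (norm (m + d))\<^sup>2 - 2 * inner (m + d) d + (norm d)\<^sup>2"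
    by (simp add: power2_norm_eq_inner inner_add_left inner_add_right inner_commute)
  then have "(norm (m + d))\<^sup>2 \<le> (norm m)\<^sup>2 + 2 * inner (m + d) d"
    by simp
  from divide_right_mono[OF this, of "2 * h"] assms show ?thesis
    by (simp add: add_divide_distrib)
qed

text \<open>The increment does not touch the height, so the \<Phi> term is unchanged and only the
  two kinetic energies vary, both with the same \<open>h\<close>.\<close>

lemma Etot_tangent:
  assumes "V = U + dt *\<^sub>R (0, A, B)" "0 < height U"
  shows "Etot \<Phi> V \<le> Etot \<Phi> U + dt * (inner (vel_u V) A + inner (vel_v V) B)"
proof -
  obtain h m w where U: "U = (h, m, w)" by (cases U)
  have V: "V = (h, m + dt *\<^sub>R A, w + dt *\<^sub>R B)"
    using assms(1) U by simp
  have "0 < h" using assms(2) U by (simp add: height_def)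
  from kinetic_energy_tangent[OF this, of m "dt *\<^sub>R A"] kinetic_energy_tangent[OF this, of w "dt *\<^sub>R B"]
  show ?thesis
    unfolding U V by (simp add: Etot_def vel_u_def vel_v_def height_def distrib_left)
qed

text \<open>The mixed time levels in \<open>f\<close> and \<open>g\<close> are harmless: the
  cancellation only needs the same \<open>f\<close> and \<open>g\<close> in both momentum equations
  and the symmetry of \<open>f\<close>.\<close>

lemma capillary_increment_skew:
  fixes \<sigma> Ecap \<alpha> :: "real \<Rightarrow> real" and Uhalf Unew :: "('nx::finite, 'ny::finite) cell \<Rightarrow> state"
  assumes dual: "\<forall>b \<phi>. grid_inner dx dy b (grad3 \<phi>) = - grid_inner dx dy (div3 b) \<phi>"
    and mesh: "0 < dx" "0 < dy"
  defines "M \<equiv> capillary_increment \<sigma> Ecap \<alpha> dx dy grad3 div3 Uhalf Unew"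
  shows "(\<Sum>K\<in>UNIV. inner (vel_u (Unew K)) (fst (snd (M K))) + inner (vel_v (Unew K)) (snd (snd (M K)))) = 0"
proof -
  define h where "h = (\<lambda>L. height (Unew L))"
  define u where "u = (\<lambda>L. vel_u (Unew L))"
  define v where "v = (\<lambda>L. vel_v (Unew L))"
  define f where "f = (\<lambda>L. f_cap \<sigma> Ecap \<alpha> (h L) (vel_v (Uhalf L)))"
  define g where "g = (\<lambda>L. g_cap \<sigma> Ecap \<alpha> (h L) (vel_v (Uhalf L)))"
  have M: "M K = (0, - grad3 (\<lambda>L. inner (g L) (v L)) K + div_h_grad dx dy h (\<lambda>L. f L *v v L) K,
      - (div3 u K *\<^sub>R g K) - f K *v div_h_grad dx dy h u K)" for K
    unfolding M_def capillary_increment_def Let_def g_def f_def v_def u_def h_def ..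
  \<comment> \<open>Duality is applied to the new velocity \<open>u\<close> and the scalar field
    \<open>inner (g L) (v L)\<close>; the common cell measure is then divided out.\<close>
  have "cell_measure dx dy * (\<Sum>K\<in>UNIV. inner (u K) (grad3 (\<lambda>L. inner (g L) (v L)) K)) =
      cell_measure dx dy * - (\<Sum>K\<in>UNIV. div3 u K * inner (g K) (v K))"
    using dual[rule_format, of u "\<lambda>L. inner (g L) (v L)"]
    by (simp add: grid_inner_def flip: sum_distrib_left)
  moreover have "cell_measure dx dy \<noteq> 0"
    using mesh by (simp add: cell_measure_def)
  ultimately have grad: "(\<Sum>K\<in>UNIV. inner (u K) (grad3 (\<lambda>L. inner (g L) (v L)) K)) =
      - (\<Sum>K\<in>UNIV. div3 u K * inner (g K) (v K))"
    by (simp only: mult_cancel_left) simp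
  \<comment> \<open>Symmetry of \<open>f K\<close> moves it from the capillary operator in the
    \<open>v\<close> equation onto \<open>v\<close>, matching the argument of the operator in the
    \<open>u\<close> equation.\<close>
  have "inner (v K) (f K *v w) = inner w (f K *v v K)" for K w
    using dot_lmul_matrix[of "v K" "f K" w] transpose_matrix_vector[of "f K" "v K"]
    by (simp add: f_def f_cap_symmetric inner_commute)
  then have sym: "(\<Sum>K\<in>UNIV. inner (v K) (f K *v div_h_grad dx dy h u K)) =
      (\<Sum>K\<in>UNIV. inner (u K) (div_h_grad dx dy h (\<lambda>L. f L *v v L) K))"
    using div_h_grad_self_adjoint[of dx dy h u "\<lambda>L. f L *v v L"] by (simp add: inner_commute)
  have "(\<Sum>K\<in>UNIV. inner (u K) (fst (snd (M K))) + inner (v K) (snd (snd (M K)))) = 0"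
    by (simp add: M inner_add_right inner_diff_right sum.distrib sum_subtractf sum_negf grad sym inner_commute)
  then show ?thesis
    by (simp only: u_def v_def)
qed

theorem proposition3p4:
  fixes \<Phi> \<sigma> Ecap \<alpha> :: "real \<Rightarrow> real"
    and dx dy dt a :: real
    and N :: "state \<Rightarrow>\<^sub>L state_flux \<Rightarrow> real"
    and G :: "state \<Rightarrow> state \<Rightarrow> real^2 \<Rightarrow> state"
    and grad3 :: "(('nx::finite, 'ny::finite) cell \<Rightarrow> real) \<Rightarrow> (('nx, 'ny) cell \<Rightarrow> real^2)"
    and div3 :: "(('nx, 'ny) cell \<Rightarrow> real^2) \<Rightarrow> (('nx, 'ny) cell \<Rightarrow> real)"
    and Uold Uhalf Unew :: "('nx, 'ny) cell \<Rightarrow> state"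
  assumes Phi: "smooth_on_pos \<Phi>" "\<forall>h>0. 0 < \<Phi> h"
    and sigma: "smooth_on_pos \<sigma>" "\<forall>h>0. 0 < \<sigma> h"
    and pressure: "\<forall>h>0. 0 < deriv (pressure \<Phi>) h"
    and Ecap: "bij_betw Ecap {0..} {0..}" "Ecap 0 = 0"
    and alpha: "alpha_extension Ecap \<alpha>"
    and mesh: "0 < dx" "0 < dy"
    and dt: "0 < dt"
    and N: "is_norm N"
    and grad3_div3: "grid_linear grad3" "grid_linear div3"
      "\<forall>b \<phi>. grid_inner dx dy b (grad3 \<phi>) = - grid_inner dx dy (div3 b) \<phi>"
    and a: "0 < a" "a < 1"
    and G: "conservative_flux TYPE('nx) TYPE('ny) G"
      "entropy_satisfying TYPE('nx) TYPE('ny) \<Phi> N a dx dy G"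
    and hyperbolic: "\<forall>K. Uhalf K = hyperbolic_step dx dy dt G Uold K"
    and capillary:
      "\<forall>K. Unew K = Uhalf K + dt *\<^sub>R capillary_increment \<sigma> Ecap \<alpha> dx dy grad3 div3 Uhalf Unew K"
    and hn: "\<forall>K. 0 < height (Uold K)"
    and CFL: "CFL \<Phi> N a dx dy dt Uold"
  shows "(\<forall>K. 0 < height (Unew K)) \<and>
    (\<Sum>K\<in>UNIV. Etot \<Phi> (Unew K) * cell_measure dx dy) \<le> (\<Sum>K\<in>UNIV. Etot \<Phi> (Uold K) * cell_measure dx dy)"
proof -
  define M where "M = capillary_increment \<sigma> Ecap \<alpha> dx dy grad3 div3 Uhalf Unew"
  have fst_M: "fst (M K) = 0" for K
    by (simp add: M_def capillary_increment_def Let_def)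
  \<comment> \<open>The explicit zero gives the shape that \<open>Etot_tangent\<close> expects and
    freezes the height.\<close>
  have Unew: "Unew K = Uhalf K + dt *\<^sub>R (0, fst (snd (M K)), snd (snd (M K)))" for K
    using capillary fst_M[of K] by (metis M_def prod.collapse)
  have half: "Uhalf = hyperbolic_step dx dy dt G Uold"
    by (rule ext, rule hyperbolic[rule_format])
  have half_pos: "0 < height (Uhalf K)" for K
    unfolding half by (rule hyperbolic_step_energy(1)[OF G(2) dt hn CFL])
  have "height (Unew K) = height (Uhalf K)" for K
    by (subst Unew) (simp add: height_def)
  then have pos: "0 < height (Unew K)" for K
    using half_pos by simp
  have "(\<Sum>K\<in>UNIV. Etot \<Phi> (Unew K)) \<le> (\<Sum>K\<in>UNIV. Etot \<Phi> (Uhalf K) + dt *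
      (inner (vel_u (Unew K)) (fst (snd (M K))) + inner (vel_v (Unew K)) (snd (snd (M K)))))"
    by (intro sum_mono Etot_tangent Unew half_pos)
  also have "\<dots> = (\<Sum>K\<in>UNIV. Etot \<Phi> (Uhalf K))"
    using capillary_increment_skew[OF grad3_div3(3) mesh,
        where \<sigma> = \<sigma> and Ecap = Ecap and \<alpha> = \<alpha> and Uhalf = Uhalf and Unew = Unew]
    by (simp add: sum.distrib M_def flip: sum_distrib_left)
  also have "\<dots> \<le> (\<Sum>K\<in>UNIV. Etot \<Phi> (Uold K))"
    unfolding half by (rule hyperbolic_step_energy(2)[OF G(2) dt hn CFL])
  \<comment> \<open>On the uniform mesh all cells have the same measure, so one multiplication
    restores the weights.\<close>
  finally have "(\<Sum>K\<in>UNIV. Etot \<Phi> (Unew K)) * cell_measure dx dy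
      \<le> (\<Sum>K\<in>UNIV. Etot \<Phi> (Uold K)) * cell_measure dx dy"
    using mesh by (intro mult_right_mono) (auto simp: cell_measure_def)
  with pos show ?thesis
    by (simp add: sum_distrib_right)
qed

end
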